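(* Let $x$ be an odd integer with $x>1$, let $t\ge2$ be an integer, and let $a,b,c\ge0$ be integers with $b+c\ge1$. Let $L=\{1^a,x^b,(tx)^c\}$, a multiset of size $v-1$ where $v=a+b+c+1$, and suppose $v\ge (t+2)x$. Let $q=\lfloor v/x\rfloor$. If $a\ge\omega(x,b+c)$ and $b\ge 2q+tx-2t+1$, then $L$ has a standard linear realization.
   Context: For a positive integer $n$, $K_n$ is the complete graph on vertex set $\{0,\dots,n-1\}$ and the linear length of an edge $\{u,w\}$ is $|u-w|$. A multiset of positive integers of size $n-1$ has a linear realization if some Hamiltonian path in $K_n$ has multiset of linear edge lengths equal to it; it is standard if the path starts at $0$. $\{x_1^{a_1},\dots\}$ denotes the multiset with $x_i$ of multiplicity $a_i$. For integers $z\ge2$, $d\ge0$, $\omega(z,d)$ is the smallest integer $a\ge0$ such that $\{1^a,z^d\}$ has a standard linear realization. *)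

theory Defs
  imports Main "HOL-Library.Multiset"
begin

definition hamiltonian_path :: "'a set \<Rightarrow> 'a set set \<Rightarrow> 'a list \<Rightarrow> bool" where
  "hamiltonian_path V E p \<longleftrightarrow>
     distinct p \<and> set p = V \<and> successively (\<lambda>u w. {u, w} \<in> E) p"

definition complete_edges :: "nat \<Rightarrow> nat set set" where
  "complete_edges n = {{u, w} | u w. u < n \<and> w < n \<and> u \<noteq> w}"

definition linear_length :: "nat \<Rightarrow> nat \<Rightarrow> nat" where
  "linear_length u w = nat \<bar>int u - int w\<bar>"

definition path_lengths :: "nat list \<Rightarrow> nat multiset" where
  "path_lengths p = mset (map2 linear_length p (tl p))"

text \<open>The number of vertices is determined by the multiset: \<open>n = size L + 1\<close>.\<close>

definition linear_realization :: "nat list \<Rightarrow> nat multiset \<Rightarrow> bool" where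
  "linear_realization p L \<longleftrightarrow>
     hamiltonian_path {0..<size L + 1} (complete_edges (size L + 1)) p \<and> path_lengths p = L"

definition has_standard_linear_realization :: "nat multiset \<Rightarrow> bool" where
  "has_standard_linear_realization L \<longleftrightarrow> (\<exists>p. linear_realization p L \<and> hd p = 0)"

text \<open>
  For \<open>z \<ge> 2\<close> some \<open>a\<close> always exists. The path \<open>m, m + z, m + z - 1, \<dots>, m + 1, m + z + 1\<close>
  visits exactly \<open>{m..m + z + 1}\<close> with two edges of length \<open>z\<close> and all others of length 1. Such
  blocks are chained from \<open>m = 0\<close>, and for odd \<open>d\<close> followed by \<open>m, m + z, m + z - 1, \<dots>, m + 1\<close>.
\<close>

definition omega :: "nat \<Rightarrow> nat \<Rightarrow> nat" where
  "omega z d =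
     (LEAST a. has_standard_linear_realization (replicate_mset a 1 + replicate_mset d z))"

end

theory Submission
  imports Defs
begin

text \<open>
  Consider the residue classes modulo \<open>x\<close> as columns of a grid: edges of lengths \<open>x\<close> and
  \<open>t * x\<close> stay in a column, edges of length 1 lead to an adjacent one. A standard realization of
  \<open>{1\<^sup>h\<^sup>-\<^sup>1\<^sup>-\<^sup>k, t\<^sup>k}\<close>, multiplied by \<open>x\<close>, traverses a column
  of height \<open>h\<close> with \<open>k\<close> edges of length \<open>t * x\<close>. Traversing a column of this kind and then an adjacent
  column of equal height in reverse leads back to the bottom row whatever the end point was, so \<open>k\<close> can
  be chosen independently for each pair of columns, and a single last column adjusts the parity of \<open>c\<close>.
  This needs \<open>x - 1\<close> edges of length 1 if \<open>b + c\<close> modulo \<open>x\<close> is even or 1, and \<open>x\<close> of them otherwise.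
  Conversely, \<open>\<omega>(x, b + c)\<close> is at least this number, and further edges of length 1 can be put in front.
\<close>

section \<open>Path lengths and standard realizations\<close>

lemma path_lengths_simps [simp]:
  "path_lengths [] = {#}"
  "path_lengths [u] = {#}"
  "path_lengths (u # w # p) = add_mset (linear_length u w) (path_lengths (w # p))"
  by (simp_all add: path_lengths_def)

lemma linear_length_commute: "linear_length u w = linear_length w u"
  by (simp add: linear_length_def abs_minus_commute)

lemma path_lengths_append:
  assumes "p \<noteq> []" "p' \<noteq> []"
  shows "path_lengths (p @ p') =
    add_mset (linear_length (last p) (hd p')) (path_lengths p + path_lengths p')"
  using assms
proof (induction p rule: induct_list012)
  case (2 u)
  then show ?case by (cases p') auto
qed auto

lemma path_lengths_rev: "path_lengths (rev p) = path_lengths p"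
proof (induction p rule: induct_list012)
  case (3 u w p)
  then show ?case
    using path_lengths_append[of "rev p @ [w]" "[u]"] by (simp add: linear_length_commute)
qed auto

lemma linear_length_affine: "linear_length (g + i * z) (g + j * z) = linear_length i j * z"
proof -
  have "int (g + i * z) - int (g + j * z) = (int i - int j) * int z"
    by (simp add: algebra_simps)
  then show ?thesis
    by (simp add: linear_length_def abs_mult nat_mult_distrib)
qed

lemma path_lengths_affine:
  "path_lengths (map (\<lambda>j. g + j * z) p) = image_mset (\<lambda>n. n * z) (path_lengths p)"
  by (induction p rule: induct_list012) (auto simp: linear_length_affine)

lemma size_path_lengths: "size (path_lengths p) = length p - 1"
  by (induction p rule: induct_list012) auto

text \<open>The multiset fixes the length of the list to \<open>size L + 1\<close>, so a list
  covering that many vertices has no room for a repetition or a foreign vertex. The constructions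
  below therefore only check that every vertex is covered.\<close>

lemma standard_realizationI:
  assumes "p \<noteq> []" "hd p = 0" "path_lengths p = L" "{..size L} \<subseteq> set p"
  shows "has_standard_linear_realization L"
proof -
  have len: "length p = size L + 1"
    using assms(1,3) size_path_lengths[of p] by (cases p) auto
  have "card {..size L} \<le> card (set p)"
    using assms(4) by (intro card_mono) auto
  then have card: "card (set p) = length p"
    using card_length[of p] len by simp
  then have dist: "distinct p"
    by (rule card_distinct)
  have set: "set p = {0..<size L + 1}"
    using card_subset_eq[OF _ assms(4)] card len
    by (simp add: atLeast0LessThan lessThan_Suc_atMost)
  have "successively (\<lambda>u w. u \<noteq> w \<and> u \<in> set p \<and> w \<in> set p) p"
    using dist by (auto simp: successively_conv_nth nth_eq_iff_index_eq)
  then have "successively (\<lambda>u w. {u, w} \<in> complete_edges (size L + 1)) p"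
    by (rule successively_mono) (auto simp: set complete_edges_def)
  then show ?thesis
    unfolding has_standard_linear_realization_def linear_realization_def hamiltonian_path_def
    using dist set assms by blast
qed

lemma standard_realizationE:
  assumes "has_standard_linear_realization L"
  obtains p where "p \<noteq> []" "hd p = 0" "path_lengths p = L" "set p = {0..<size L + 1}" "distinct p"
proof -
  obtain p where p: "linear_realization p L" "hd p = 0"
    using assms unfolding has_standard_linear_realization_def by blast
  moreover from p have "p \<noteq> []"
    unfolding linear_realization_def hamiltonian_path_def by auto
  ultimately show thesis
    using that unfolding linear_realization_def hamiltonian_path_def by blast
qed

text \<open>Shift the path up by one and start it with the edge from 0 to 1.\<close>

lemma standard_realization_add_one:
  assumes "has_standard_linear_realization L"
  shows "has_standard_linear_realization (add_mset 1 L)"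
proof -
  obtain p where p: "p \<noteq> []" "hd p = 0" "path_lengths p = L" "set p = {0..<size L + 1}"
    using assms by (rule standard_realizationE)
  let ?p = "0 # map (\<lambda>j. 1 + j * 1) p"
  have "path_lengths ?p = path_lengths [0] + path_lengths (map (\<lambda>j. 1 + j * 1) p) + {#1#}"
    using path_lengths_append[of "[0]" "map (\<lambda>j. 1 + j * 1) p"] p(1,2)
    by (simp add: hd_map linear_length_def)
  then have "path_lengths ?p = add_mset 1 L"
    using p(3) by (simp only: path_lengths_affine) simp
  moreover have "{..size (add_mset 1 L)} \<subseteq> set ?p"
  proof
    fix u assume u: "u \<in> {..size (add_mset 1 L)}"
    show "u \<in> set ?p"
      using u p(4) by (cases u) (auto simp: image_iff)
  qed
  ultimately show ?thesis
    by (intro standard_realizationI[of ?p]) auto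
qed

lemma standard_realization_mono:
  assumes "has_standard_linear_realization (replicate_mset a 1 + L)" "a \<le> a'"
  shows "has_standard_linear_realization (replicate_mset a' 1 + L)"
  using assms(2,1)
  by (induction a' rule: dec_induct) (use standard_realization_add_one in auto)

section \<open>A lower bound for the number of edges of length 1\<close>

text \<open>Edges are unordered pairs, so that an edge of length \<open>n\<close> is identified by
  its lower end whichever way the path runs.\<close>

definition path_edges :: "nat list \<Rightarrow> nat set set" where
  "path_edges p = set (map2 (\<lambda>u w. {u, w}) p (tl p))"

lemma path_edges_simps [simp]:
  "path_edges [] = {}"
  "path_edges [u] = {}"
  "path_edges (u # w # p) = insert {u, w} (path_edges (w # p))"
  by (simp_all add: path_edges_def)

lemma path_edges_subset: "e \<in> path_edges p \<Longrightarrow> e \<subseteq> set p"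
  by (induction p rule: induct_list012) auto

lemma path_edge_length: "{u, w} \<in> path_edges p \<Longrightarrow> linear_length u w \<in># path_lengths p"
  by (induction p rule: induct_list012) (auto simp: doubleton_eq_iff linear_length_commute)

text \<open>A path without repeated vertices uses no edge twice, so multiplicities of lengths count
  actual pairs of vertices.\<close>

lemma card_edges_of_length:
  assumes "distinct p" "n > 0"
  shows "card {u. {u, u + n} \<in> path_edges p} = count (path_lengths p) n"
  using assms(1)
proof (induction p rule: induct_list012)
  case (3 a b p)
  let ?T = "{u. {u, u + n} \<in> path_edges (b # p)}"
  have IH: "card ?T = count (path_lengths (b # p)) n"
    using 3 by simp
  have fin: "finite ?T"
    using path_edges_subset[of _ "b # p"] by (intro finite_subset[of ?T "set (b # p)"]) auto
  have a: "{a, b} \<notin> path_edges (b # p)"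
    using path_edges_subset[of "{a, b}" "b # p"] 3(3) by auto
  show ?case
  proof (cases "linear_length a b = n")
    case True
    have m: "{a, b} = {min a b, min a b + n}"
      using True assms(2) by (auto simp: linear_length_def min_def)
    have "{u. {u, u + n} \<in> path_edges (a # b # p)} = insert (min a b) ?T"
      using m assms(2) by (auto simp: doubleton_eq_iff)
    moreover have "min a b \<notin> ?T"
      using a m by auto
    ultimately show ?thesis
      using fin IH True by simp
  next
    case False
    have "{u. {u, u + n} \<in> path_edges (a # b # p)} = ?T"
      using False by (auto simp: doubleton_eq_iff linear_length_def)
    then show ?thesis
      using IH False by simp
  qed
qed auto

definition neighbours :: "nat list \<Rightarrow> nat \<Rightarrow> nat set" where
  "neighbours p u = {w. {u, w} \<in> path_edges p}"

lemma finite_neighbours: "finite (neighbours p u)"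
  using path_edges_subset[of _ p] finite_subset[of "neighbours p u" "set p"]
  by (auto simp: neighbours_def)

lemma card_neighbours:
  assumes "distinct p"
  shows "card (neighbours p u) \<le> 2" and "p \<noteq> [] \<Longrightarrow> card (neighbours p (hd p)) \<le> 1"
proof -
  \<comment> \<open>Both bounds go through the induction together: prepending a vertex gives one
    more neighbour to the old head, which had at most one.\<close>
  have "card (neighbours p u) \<le> 2 \<and> (p \<noteq> [] \<longrightarrow> card (neighbours p (hd p)) \<le> 1)"
    using assms
  proof (induction p arbitrary: u rule: induct_list012)
    case (3 a b p)
    let ?N = "neighbours (b # p)"
    have IH: "card (?N w) \<le> 2" "card (?N b) \<le> 1" for w
      using 3 by auto
    have "?N a = {}"
      using path_edges_subset[of _ "b # p"] 3(3) by (auto simp: neighbours_def)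
    then have a: "neighbours (a # b # p) a = {b}"
      by (auto simp: neighbours_def doubleton_eq_iff)
    have b: "neighbours (a # b # p) b = insert a (?N b)"
      by (auto simp: neighbours_def doubleton_eq_iff)
    have o: "neighbours (a # b # p) w = ?N w" if "w \<noteq> a" "w \<noteq> b" for w
      using that by (auto simp: neighbours_def doubleton_eq_iff)
    have "card (neighbours (a # b # p) b) \<le> 2"
      using IH(2) unfolding b by (intro order.trans[OF card_insert_le_m1]) auto
    then show ?case
      using a o[of u] IH(1)[of u] by (cases "u = a"; cases "u = b") auto
  qed (auto simp: neighbours_def)
  then show "card (neighbours p u) \<le> 2" and "p \<noteq> [] \<Longrightarrow> card (neighbours p (hd p)) \<le> 1"
    by auto
qed

lemma not_three_neighbours:
  assumes "distinct p" "{u, w1} \<in> path_edges p" "{u, w2} \<in> path_edges p" "{u, w3} \<in> path_edges p"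
    and "w1 \<noteq> w2" "w1 \<noteq> w3" "w2 \<noteq> w3"
  shows False
proof -
  have "card {w1, w2, w3} \<le> card (neighbours p u)"
    using assms finite_neighbours by (intro card_mono) (auto simp: neighbours_def)
  then show False
    using card_neighbours(1)[OF assms(1), of u] assms by simp
qed

text \<open>A path is connected, so if it starts outside \<open>S\<close> it cannot reach a set that
  no edge leaves.\<close>

lemma path_avoids_closed_set:
  assumes "\<And>u w. u \<in> S \<Longrightarrow> {u, w} \<in> path_edges p \<Longrightarrow> w \<in> S" "p \<noteq> []" "hd p \<notin> S"
  shows "set p \<inter> S = {}"
  using assms
proof (induction p rule: induct_list012)
  case (3 a b p)
  have "b \<notin> S"
  proof
    assume "b \<in> S"
    moreover have "{b, a} \<in> path_edges (a # b # p)"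
      by (simp add: doubleton_eq_iff)
    ultimately have "a \<in> S"
      by (rule 3(3))
    then show False
      using 3(5) by simp
  qed
  moreover have "w \<in> S" if "u \<in> S" "{u, w} \<in> path_edges (b # p)" for u w
    using 3(3)[of u w] that by simp
  ultimately have "set (b # p) \<inter> S = {}"
    by (intro 3(2)) simp_all
  then show ?case
    using 3(5) by simp
qed simp_all

section \<open>Residues along a path\<close>

lemma same_residue_if_length: "linear_length u w = z \<Longrightarrow> u mod z = w mod z"
proof -
  assume "linear_length u w = z"
  then have "u = w + z \<or> w = u + z"
    by (auto simp: linear_length_def)
  then show ?thesis
    by auto
qed

text \<open>Only a step of length 1 can change the residue, and each such step contributes at most
  one new residue.\<close>

lemma card_residues_le:
  assumes "set_mset (path_lengths p) \<subseteq> {1, z}"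
  shows "card ((\<lambda>u. u mod z) ` set p) \<le> Suc (count (path_lengths p) 1)"
  using assms
proof (induction p rule: induct_list012)
  case (3 a b p)
  let ?R = "(\<lambda>u. u mod z) ` set (b # p)"
  have IH: "card ?R \<le> Suc (count (path_lengths (b # p)) 1)"
    using 3 by simp
  have im: "(\<lambda>u. u mod z) ` set (a # b # p) = insert (a mod z) ?R"
    by simp
  show ?case
  proof (cases "linear_length a b = 1")
    case True
    then show ?thesis
      unfolding im using IH card_insert_le_m1[of "Suc (card ?R)" ?R "a mod z"] by simp
  next
    case False
    then have "a mod z = b mod z"
      using 3(3) by (intro same_residue_if_length) auto
    then show ?thesis
      unfolding im using IH False by (simp add: insert_absorb)
  qed
qed auto

lemma ones_lower_bound:
  assumes "has_standard_linear_realization (replicate_mset a 1 + replicate_mset d z)"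
    and "z > 1" "z \<le> a + d + 1"
  shows "z - 1 \<le> a"
proof -
  obtain p where p: "p \<noteq> []" "hd p = 0" "path_lengths p = replicate_mset a 1 + replicate_mset d z"
      "set p = {0..<size (replicate_mset a 1 + replicate_mset d z) + 1}"
    using assms(1) by (rule standard_realizationE)
  \<comment> \<open>All residues occur among the first \<open>z\<close> vertices, which exist since
    \<open>z \<le> a + d + 1\<close>.\<close>
  have "{..<z} \<subseteq> (\<lambda>u. u mod z) ` set p"
  proof
    fix u assume "u \<in> {..<z}"
    then show "u \<in> (\<lambda>u. u mod z) ` set p"
      using p(4) assms(3) by (intro image_eqI[of _ _ u]) auto
  qed
  then have "z \<le> card ((\<lambda>u. u mod z) ` set p)"
    using card_mono[of "(\<lambda>u. u mod z) ` set p" "{..<z}"] by simp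
  also have "\<dots> \<le> Suc (count (path_lengths p) 1)"
    using p(3) by (intro card_residues_le) (auto split: if_splits)
  finally show ?thesis
    using p(3) assms(2) by simp
qed

section \<open>Sets of integers without two consecutive elements\<close>

lemma inj_on_halves:
  fixes A :: "nat set"
  assumes "A \<subseteq> {s..}" "\<And>u. u \<in> A \<Longrightarrow> Suc u \<notin> A"
  shows "inj_on (\<lambda>u. (u - s) div 2) A"
proof (rule inj_onI)
  fix u w assume *: "u \<in> A" "w \<in> A" "(u - s) div 2 = (w - s) div 2"
  obtain i j where "u = s + i" "w = s + j"
    using * assms(1) by (metis atLeast_iff le_iff_add subsetD)
  then have "u = w \<or> u = Suc w \<or> w = Suc u"
    using *(3) by simp presburger
  then show "u = w"
    using * assms(2) by auto
qed

lemma card_sparse_le: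
  fixes A :: "nat set"
  assumes "A \<subseteq> {s..<s + 2 * m}" "\<And>u. u \<in> A \<Longrightarrow> Suc u \<notin> A"
  shows "card A \<le> m"
proof -
  have "card A \<le> card {..<m}"
    using assms by (intro card_inj_on_le[OF inj_on_halves[of A s]]) (auto simp: subset_iff)
  then show ?thesis by simp
qed

text \<open>Each of the \<open>m\<close> blocks \<open>{s + 2 * i, s + 2 * i + 1}\<close> contains
  exactly one element. The last block is cut down to its first point, and going downwards the second
  point of a block is excluded by the first point of the next one.\<close>

lemma sparse_extremal:
  fixes A :: "nat set"
  assumes "A \<subseteq> {s..<s + 2 * m - 1}" "\<And>u. u \<in> A \<Longrightarrow> Suc u \<notin> A" "card A = m" "j < m"
  shows "s + 2 * j \<in> A"
proof -
  let ?f = "\<lambda>u. (u - s) div 2"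
  have A: "s \<le> u" "u < s + 2 * m - 1" if "u \<in> A" for u
    using that assms(1) by auto
  have inj: "inj_on ?f A"
    using assms by (intro inj_on_halves) auto
  have "?f ` A = {..<m}"
  proof (rule card_subset_eq)
    show "?f ` A \<subseteq> {..<m}"
    proof safe
      fix u assume "u \<in> A"
      then show "?f u < m"
        using A[of u] by linarith
    qed
    show "card (?f ` A) = card {..<m}"
      using card_image[OF inj] assms(3) by simp
  qed simp
  then have cover: "s + 2 * i \<in> A \<or> s + 2 * i + 1 \<in> A" if i: "i < m" for i
  proof -
    obtain u where u: "u \<in> A" "?f u = i"
      using i \<open>?f ` A = {..<m}\<close> by (metis (no_types, lifting) imageE lessThan_iff)
    then have "u = s + 2 * i \<or> u = s + 2 * i + 1"
      using A(1)[OF u(1)] by linarith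
    then show ?thesis
      using u by auto
  qed
  have "j \<le> m - 1"
    using assms(4) by simp
  then show ?thesis
  proof (induction j rule: inc_induct)
    case base
    have "s + 2 * (m - 1) + 1 \<notin> A"
      using A(2)[of "s + 2 * (m - 1) + 1"] assms(4) by auto
    then show ?case
      using cover[of "m - 1"] assms(4) by auto
  next
    case (step i)
    then have "s + 2 * i + 1 \<notin> A"
      using assms(2)[of "s + 2 * i + 1"] by auto
    then show ?case
      using cover[of i] step by auto
  qed
qed

lemma mod_inj_window:
  fixes s u w x :: nat
  assumes "s \<le> u" "u < s + x" "s \<le> w" "w < s + x" "u mod x = w mod x"
  shows "u = w"
  using assms
proof (induction u w rule: linorder_wlog)
  case (le u w)
  have "x dvd w - u"
    using mod_eq_dvd_iff_nat[OF le(1), of x] le by simp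
  moreover have "w - u < x"
    using le by linarith
  ultimately have "w - u = 0"
    using nat_dvd_not_less by blast
  then show ?case
    using le(1) by simp
qed simp

text \<open>There are only \<^term>\<open>d\<close> pairs at distance \<^term>\<open>x\<close>, so all of them are edges of the path, and
  the degree bound makes the edges of length 1 a matching on the first \<^term>\<open>x\<close> and a matching on the
  last \<^term>\<open>x\<close> vertices, both of maximum size as \<open>0\<close> has degree 1. Two residue classes
  matched to each other at both ends would form a cycle.\<close>

lemma no_realization_with_fewest_ones:
  assumes "odd x" "odd (d mod x)" "3 \<le> d mod x" "x \<le> d"
  shows "\<not> has_standard_linear_realization (replicate_mset (x - 1) 1 + replicate_mset d x)"
proof
  assume real: "has_standard_linear_realization (replicate_mset (x - 1) 1 + replicate_mset d x)"
  obtain m where m: "x = 2 * m + 1"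
    using assms(1) by (elim oddE)
  define r where "r = d mod x"
  have r: "odd r" "3 \<le> r" "r < x"
    using assms unfolding r_def m by auto
  have rx: "r + 2 \<le> x"
    using r m by presburger
  \<comment> \<open>The number of vertices; exactly \<open>v - x = d\<close> pairs of vertices are
    at distance \<open>x\<close>.\<close>
  define v where "v = x + d"
  have vx: "v - x = d" "x + 3 \<le> d"
  proof -
    have "d = d div x * x + r" "d div x > 0"
      using assms(4) r by (simp_all add: r_def div_greater_zero_iff)
    moreover have "x \<le> d div x * x"
      using calculation(2) by simp
    ultimately show "x + 3 \<le> d"
      using r by linarith
  qed (simp add: v_def)
  obtain p where p: "p \<noteq> []" "hd p = 0"
      "path_lengths p = replicate_mset (x - 1) 1 + replicate_mset d x"
      "set p = {0..<size (replicate_mset (x - 1) 1 + replicate_mset d x) + 1}" "distinct p"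
    using real by (rule standard_realizationE)
  have setp: "set p = {0..<v}"
    using p(4) r by (simp add: v_def)
  let ?E = "path_edges p"
  have inV: "u < v" if "{u, w} \<in> ?E" for u w
    using path_edges_subset[OF that] setp by auto
  have vert: "{u, u + x} \<in> ?E" if "u < d" for u
  proof -
    have "{u. {u, u + x} \<in> ?E} = {..<d}"
    proof (rule card_subset_eq)
      show "{u. {u, u + x} \<in> ?E} \<subseteq> {..<d}"
      proof
        fix u assume "u \<in> {u. {u, u + x} \<in> ?E}"
        then have "u + x < v"
          using path_edges_subset setp by fastforce
        then show "u \<in> {..<d}"
          unfolding v_def by simp
      qed
      show "card {u. {u, u + x} \<in> ?E} = card {..<d}"
        using card_edges_of_length[OF p(5), of x] p(3) r by simp
    qed simp
    then show ?thesis
      using that by auto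
  qed
  have vert': "{u, u - x} \<in> ?E" if "x \<le> u" "u < v" for u
    using vert[of "u - x"] that by (simp add: insert_commute v_def)
  define M where "M = {u. {u, Suc u} \<in> ?E}"
  have cardM: "card M = 2 * m"
    using card_edges_of_length[OF p(5), of 1] p(3) r m by (simp add: M_def)
  have Mv: "Suc u < v" if "u \<in> M" for u
    using inV[of "Suc u" u] that by (simp add: M_def insert_commute)
  have M: "{u, Suc u} \<in> ?E" "{Suc u, u} \<in> ?E" if "u \<in> M" for u
    using that by (auto simp: M_def insert_commute)
  \<comment> \<open>Every vertex has an edge of length \<open>x\<close>, so two edges of length 1 at
    one vertex would give degree 3.\<close>
  have sparse: "Suc u \<notin> M" if u: "u \<in> M" for u
  proof
    assume u': "Suc u \<in> M"
    obtain w where "{Suc u, w} \<in> ?E" "w = Suc u + x \<or> Suc u = w + x"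
    proof (cases "Suc u < d")
      case True
      then show ?thesis
        using vert that by blast
    next
      case False
      then show ?thesis
        using vert'[of "Suc u"] that[of "Suc u - x"] Mv[OF u] vx by auto
    qed
    then show False
      using not_three_neighbours[OF p(5) M(2)[OF u] M(1)[OF u'], of w] r by auto
  qed
  \<comment> \<open>The path starts at 0, whose only edge is already the one to
    \<open>x\<close>.\<close>
  have pos: "u > 0" if u: "u \<in> M" for u
  proof (rule ccontr)
    assume "\<not> u > 0"
    then have "{1, x} \<subseteq> neighbours p 0"
      using M(1)[OF u] vert[of 0] vx by (auto simp: neighbours_def)
    then have "card {1, x} \<le> card (neighbours p 0)"
      using finite_neighbours by (intro card_mono)
    then show False
      using card_neighbours(2)[OF p(5,1)] p(2) r by simp
  qed
  \<comment> \<open>A vertex with a partner at distance \<open>x\<close> both above and below has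
    its degree exhausted.\<close>
  have ends: "w < x \<or> d \<le> w" if w: "{w, w'} \<in> ?E" "w' = Suc w \<or> w = Suc w'" for w w'
  proof (rule ccontr)
    assume c: "\<not> (w < x \<or> d \<le> w)"
    then have "w' \<noteq> w + x" "w' \<noteq> w - x" "w + x \<noteq> w - x" "w < d" "x \<le> w" "w < v"
      using w(2) r by (auto simp: v_def)
    then show False
      using not_three_neighbours[OF p(5) w(1) vert[of w] vert'[of w]] by blast
  qed
  \<comment> \<open>With 0 excluded, the lower ends near the bottom lie among
    \<open>2 * m - 1\<close> numbers and those near the top among \<open>2 * m\<close>. Each window
    holds at most \<open>m\<close> of them, so the total \<open>2 * m\<close> fills both.\<close>
  have split: "u \<in> {1..<1 + 2 * m - 1} \<or> u \<in> {d..<d + 2 * m}" if u: "u \<in> M" for u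
    using ends[OF M(1)[OF u]] ends[OF M(2)[OF u]] pos[OF u] Mv[OF u] vx m by (auto simp: v_def)
  define lo where "lo = M \<inter> {1..<1 + 2 * m - 1}"
  define hi where "hi = M \<inter> {d..<d + 2 * m}"
  have lo: "lo \<subseteq> {1..<1 + 2 * m - 1}" "\<And>u. u \<in> lo \<Longrightarrow> Suc u \<notin> lo"
    using sparse by (simp_all add: lo_def)
  have hi: "hi \<subseteq> {d..<d + 2 * m}" "\<And>u. u \<in> hi \<Longrightarrow> Suc u \<notin> hi"
    using sparse by (simp_all add: hi_def)
  have "card M = card lo + card hi"
  proof -
    have "M = lo \<union> hi"
      using split unfolding lo_def hi_def by blast
    moreover have "lo \<inter> hi = {}"
      using vx m by (auto simp: lo_def hi_def)
    moreover have "finite lo" "finite hi"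
      by (simp_all add: lo_def hi_def)
    ultimately show ?thesis
      using card_Un_disjoint[of lo hi] by simp
  qed
  moreover have "card lo \<le> m"
    using lo by (intro card_sparse_le[of lo 1]) auto
  moreover have "card hi \<le> m"
    using hi by (rule card_sparse_le)
  ultimately have card: "card lo = m" "card hi = m"
    using cardM by auto
  \<comment> \<open>The bottom window is one short, which forces its matching: 1 with 2, 3 with 4,
    up to \<open>x - 2\<close> with \<open>x - 1\<close>.\<close>
  have low: "i \<in> M" if "odd i" "i < x" for i
  proof -
    have "i = 1 + 2 * (i div 2)" "i div 2 < m"
      using that m by presburger+
    then have "i \<in> lo"
      using sparse_extremal[OF lo card(1), of "i div 2"] by metis
    then show ?thesis
      by (simp add: lo_def)
  qed
  \<comment> \<open>Wanted is a top edge from an odd residue to the next one, parallel to a bottom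
    edge. If an edge starts at \<open>d\<close>, its residue \<open>r\<close> is odd; otherwise the
    top window shrinks by one as well, and the forced matching ends with the edge at
    \<open>v - 2\<close> of residue \<open>r - 2\<close>.\<close>
  obtain T where T: "T \<in> M" "d \<le> T" "odd (T mod x)" "T mod x + 1 < x"
  proof (cases "d \<in> M")
    case True
    then show ?thesis
      using that[of d] r rx by (simp add: r_def)
  next
    case False
    have "hi \<subseteq> {d + 1..<d + 1 + 2 * m - 1}"
    proof
      fix u assume "u \<in> hi"
      then have "u \<noteq> d" "d \<le> u" "u < d + 2 * m"
        using False by (auto simp: hi_def)
      then show "u \<in> {d + 1..<d + 1 + 2 * m - 1}"
        by simp
    qed
    moreover have "m - 1 < m"
      using r m by simp
    ultimately have "d + 1 + 2 * (m - 1) \<in> hi"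
      using sparse_extremal[OF _ hi(2) card(2)] by blast
    moreover have "d + 1 + 2 * (m - 1) = v - 2"
      using r m by (simp add: v_def)
    moreover have "(v - 2) mod x = r - 2"
    proof -
      have "d div x * x + r = d"
        by (simp add: r_def)
      then have "v - 2 = (r - 2) + (d div x + 1) * x"
        unfolding v_def distrib_right using r(2) by linarith
      then show ?thesis
        using r(3) by (simp only: mod_mult_self1) simp
    qed
    moreover have "odd (r - 2)" "r - 2 + 1 < x"
      using r by auto
    ultimately show ?thesis
      using that[of "v - 2"] by (simp add: hi_def)
  qed
  have "T < v" "Suc T < v"
    using Mv[OF T(1)] by auto
  define i where "i = T mod x"
  have i: "odd i" "i + 1 < x" "i \<in> M" "i > 0"
    using T low[of "T mod x"] odd_pos[OF T(3)] unfolding i_def by linarith+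
  have top: "u = T" if "d \<le> u" "u < v" "u mod x = i" for u
    using mod_inj_window[of d u x T] that T(2) \<open>T < v\<close> by (simp add: v_def i_def)
  have "Suc T mod x = Suc i"
    using i by (simp add: i_def mod_Suc)
  then have top': "u = Suc T" if "d \<le> u" "u < v" "u mod x = Suc i" for u
    using mod_inj_window[of d u x "Suc T"] that T(2) \<open>Suc T < v\<close> by (simp add: v_def)
  \<comment> \<open>The two classes joined at the bottom by the edge at \<open>i\<close> and at the
    top by the edge at \<open>T\<close>. No edge leaves them, yet the path starts at 0, whose
    residue lies below \<open>i\<close>.\<close>
  define S where "S = {u. u mod x = i \<or> u mod x = Suc i}"
  have "w \<in> S" if u: "u \<in> S" "{u, w} \<in> ?E" for u w
  proof -
    have "linear_length u w \<in> {1, x}"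
      using path_edge_length[OF u(2)] p(3) by (auto split: if_splits)
    moreover have "w = Suc u \<or> u = Suc w" if "linear_length u w = 1"
      using that unfolding linear_length_def by linarith
    ultimately consider "u mod x = w mod x" | "w = Suc u" | "u = Suc w"
      using same_residue_if_length[of u w x] by blast
    then show ?thesis
    proof cases
      case 1
      then show ?thesis
        using u by (simp add: S_def)
    next
      case 2
      then have uM: "u \<in> M"
        using u by (simp add: M_def)
      \<comment> \<open>An edge of length 1 leaving upwards from class \<open>Suc i\<close> would
        start at \<open>Suc i\<close> or at \<open>Suc T\<close>, where a matching edge already
        ends.\<close>
      have "u mod x \<noteq> Suc i"
      proof
        assume *: "u mod x = Suc i"
        show False
        proof (cases "u < x")
          case True
          then show False
            using * sparse[OF i(3)] uM by simp
        next
          case False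
          then have "d \<le> u"
            using split[OF uM] m by auto
          then have "u = Suc T"
            using top' * Mv[OF uM] by simp
          then show False
            using sparse[OF T(1)] uM by simp
        qed
      qed
      then show ?thesis
        using 2 u(1) i(2) by (simp add: S_def mod_Suc)
    next
      case 3
      then have wM: "w \<in> M"
        using u by (simp add: M_def insert_commute)
      have "u mod x \<noteq> i"
      proof
        assume *: "u mod x = i"
        show False
        proof (cases "u < x")
          case True
          then show False
            using * sparse[OF wM] i 3 by simp
        next
          case False
          then have "d \<le> u"
            using split[OF wM] m 3 by auto
          then have "u = T"
            using top * Mv[OF wM] 3 by simp
          then show False
            using sparse[OF wM] T(1) 3 by simp
        qed
      qed
      then have "Suc w mod x = Suc i"
        using 3 u(1) by (simp add: S_def)
      then show ?thesis
        by (simp add: S_def mod_Suc split: if_splits)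
    qed
  qed
  then have "set p \<inter> S = {}"
    using i p(1,2) by (intro path_avoids_closed_set) (simp_all add: S_def)
  moreover have "i \<in> set p" "i \<in> S"
    using i setp vx by (simp_all add: S_def v_def)
  ultimately show False
    by blast
qed

section \<open>Sweeping through the residue classes\<close>

text \<open>Only covering and lengths are recorded, in a form that survives concatenation;
  distinctness follows at the end by counting entries.\<close>

definition walk :: "nat \<Rightarrow> nat \<Rightarrow> nat set \<Rightarrow> nat multiset \<Rightarrow> bool" where
  "walk s e A L \<longleftrightarrow> (\<exists>p. p \<noteq> [] \<and> hd p = s \<and> last p = e \<and> A \<subseteq> set p \<and> path_lengths p = L)"

lemma walk_single: "walk s s {s} {#}"
  unfolding walk_def by (rule exI[of _ "[s]"]) simp

lemma walk_join:
  assumes "walk s e A L" "walk s' e' A' L'"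
  shows "walk s e' (A \<union> A') (add_mset (linear_length e s') (L + L'))"
proof -
  obtain p p' where "p \<noteq> []" "hd p = s" "last p = e" "A \<subseteq> set p" "path_lengths p = L"
    "p' \<noteq> []" "hd p' = s'" "last p' = e'" "A' \<subseteq> set p'" "path_lengths p' = L'"
    using assms unfolding walk_def by blast
  then show ?thesis
    unfolding walk_def by (intro exI[of _ "p @ p'"]) (auto simp: path_lengths_append)
qed

lemma standard_realization_if_walk:
  assumes "walk 0 e A L" "{..size L} \<subseteq> A"
  shows "has_standard_linear_realization L"
proof -
  obtain p where "p \<noteq> []" "hd p = 0" "A \<subseteq> set p" "path_lengths p = L"
    using assms(1) unfolding walk_def by blast
  then show ?thesis
    using assms(2) by (intro standard_realizationI[of p]) auto
qed

section \<open>Columns of the grid\<close>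

definition lengths :: "nat \<Rightarrow> nat \<Rightarrow> nat \<Rightarrow> nat \<Rightarrow> nat \<Rightarrow> nat multiset" where
  "lengths z t a b c = replicate_mset a 1 + replicate_mset b z + replicate_mset c (t * z)"

lemma lengths_add: "lengths z t a b c + lengths z t a' b' c' = lengths z t (a + a') (b + b') (c + c')"
  by (rule multiset_eqI) (simp add: lengths_def)

lemma lengths_add_mset:
  "add_mset 1 (lengths z t a b c) = lengths z t (Suc a) b c"
  "add_mset z (lengths z t a b c) = lengths z t a (Suc b) c"
  by (simp_all add: lengths_def)

lemma size_lengths: "size (lengths z t a b c) = a + b + c"
  by (simp add: lengths_def)

definition column :: "nat \<Rightarrow> nat \<Rightarrow> nat \<Rightarrow> nat set" where
  "column z g h = (\<lambda>j. g + j * z) ` {..<h}"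

lemma columnI: "j < h \<Longrightarrow> u = g + j * z \<Longrightarrow> u \<in> column z g h"
  by (auto simp: column_def)

text \<open>A column of height \<^term>\<open>h\<close> can be traversed from its lowest vertex with \<^term>\<open>k\<close> steps of
  length \<^term>\<open>t * z\<close> and all other steps of length \<^term>\<open>z\<close>.\<close>

definition traversable :: "nat \<Rightarrow> nat \<Rightarrow> nat \<Rightarrow> bool" where
  "traversable t h k \<longleftrightarrow> k < h \<and>
     has_standard_linear_realization (replicate_mset (h - 1 - k) 1 + replicate_mset k t)"

text \<open>The end height \<open>e\<close> is quantified before the bottom vertex \<open>g\<close>,
  so that the traversals of two columns fit together at the same level.\<close>

lemma walk_column:
  assumes "traversable t h k"
  shows "\<exists>e. \<forall>g. walk g (g + e * z) (column z g h) (lengths z t 0 (h - 1 - k) k) \<and>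
    walk (g + e * z) g (column z g h) (lengths z t 0 (h - 1 - k) k)"
proof -
  have k: "k < h"
    and real: "has_standard_linear_realization (replicate_mset (h - 1 - k) 1 + replicate_mset k t)"
    using assms by (simp_all add: traversable_def)
  obtain p where p: "p \<noteq> []" "hd p = 0"
      "path_lengths p = replicate_mset (h - 1 - k) 1 + replicate_mset k t"
      "set p = {0..<size (replicate_mset (h - 1 - k) 1 + replicate_mset k t) + 1}"
    using real by (rule standard_realizationE)
  have "size (replicate_mset (h - 1 - k) 1 + replicate_mset k t) + 1 = h"
    using k by simp
  then have set: "set p = {..<h}"
    using p(4) by (simp only: atLeast0LessThan)
  let ?m = "\<lambda>g. map (\<lambda>j. g + j * z) p"
  have len: "path_lengths (?m g) = lengths z t 0 (h - 1 - k) k" for g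
    using p(3) by (simp add: path_lengths_affine lengths_def)
  have col: "set (?m g) = column z g h" for g
    by (simp add: set column_def)
  have ends: "hd (?m g) = g" "last (?m g) = g + last p * z" for g
    using p(1,2) by (simp_all add: hd_map last_map)
  have "walk g (g + last p * z) (column z g h) (lengths z t 0 (h - 1 - k) k)" for g
    unfolding walk_def using p(1) len[of g] col[of g] ends[of g] by (intro exI[of _ "?m g"]) simp
  moreover have "walk (g + last p * z) g (column z g h) (lengths z t 0 (h - 1 - k) k)" for g
    unfolding walk_def using p(1) len[of g] col[of g] ends[of g]
    by (intro exI[of _ "rev (?m g)"]) (simp add: path_lengths_rev hd_rev last_rev)
  ultimately show ?thesis
    by blast
qed

lemma traversable_0: "h > 0 \<Longrightarrow> traversable t h 0"
  unfolding traversable_def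
proof
  assume h: "h > 0"
  have "has_standard_linear_realization (replicate_mset 0 1 + {#})"
    by (rule standard_realizationI[of "[0]"]) auto
  from standard_realization_mono[OF this, of "h - 1"]
  show "has_standard_linear_realization (replicate_mset (h - 1 - 0) 1 + replicate_mset 0 t)"
    by simp
qed

text \<open>Here the end is known to be the top of the column, which the detour in
  \<open>falling_hook\<close> relies on.\<close>

lemma walk_column_straight:
  assumes "h > 0"
  shows "walk g (g + (h - 1) * z) (column z g h) (lengths z t 0 (h - 1) 0)"
    and "walk (g + (h - 1) * z) g (column z g h) (lengths z t 0 (h - 1) 0)"
proof -
  let ?p = "map (\<lambda>j. g + j * z) [0..<h]"
  have "path_lengths [0..<Suc n] = replicate_mset n 1" for n
  proof (induction n)
    case (Suc n)
    have "[0..<Suc (Suc n)] = [0..<Suc n] @ [Suc n]"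
      by simp
    then have "path_lengths [0..<Suc (Suc n)] = add_mset 1 (path_lengths [0..<Suc n])"
      using path_lengths_append[of "[0..<Suc n]" "[Suc n]"] by (simp add: linear_length_def)
    then show ?case
      using Suc by simp
  qed simp
  from this[of "h - 1"] have "path_lengths [0..<h] = replicate_mset (h - 1) 1"
    using assms by simp
  then have len: "path_lengths ?p = lengths z t 0 (h - 1) 0"
    by (simp add: path_lengths_affine lengths_def)
  show "walk g (g + (h - 1) * z) (column z g h) (lengths z t 0 (h - 1) 0)"
    unfolding walk_def using assms len
    by (intro exI[of _ ?p]) (simp add: hd_map last_map column_def atLeast0LessThan)
  show "walk (g + (h - 1) * z) g (column z g h) (lengths z t 0 (h - 1) 0)"
    unfolding walk_def using assms len
    by (intro exI[of _ "rev ?p"])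
      (simp add: hd_map last_map column_def path_lengths_rev hd_rev last_rev atLeast0LessThan)
qed

lemma walk_column_pair:
  assumes "traversable t h k" "linear_length g g' = 1"
  shows "walk g g' (column z g h \<union> column z g' h) (lengths z t 1 (2 * (h - 1 - k)) (2 * k))"
proof -
  obtain e where e: "\<And>g. walk g (g + e * z) (column z g h) (lengths z t 0 (h - 1 - k) k)"
      "\<And>g. walk (g + e * z) g (column z g h) (lengths z t 0 (h - 1 - k) k)"
    using walk_column[OF assms(1), of z] by blast
  have "linear_length (g + e * z) (g' + e * z) = 1"
    using assms(2) by (simp add: linear_length_def)
  then show ?thesis
    using walk_join[OF e(1)[of g] e(2)[of g']]
    by (simp only: lengths_add lengths_add_mset) (simp add: mult_2)
qed

text \<open>\<open>cap m\<close> bounds the number of long steps in each column of pair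
  \<open>m\<close>. The value \<open>B\<close> is forced by counting: a column of height
  \<open>h\<close> contributes \<open>h - 1\<close> edges.\<close>

lemma walk_column_pairs:
  assumes "\<And>i. Suc i < 2 * n \<Longrightarrow> linear_length (g i) (g (Suc i)) = 1"
    and "\<And>m k. m < n \<Longrightarrow> k \<le> cap m \<Longrightarrow> traversable t (H m) k"
    and "K \<le> sum cap {..<n}" "0 < n"
  shows "\<exists>B. B + 2 * K + 2 * n = 2 * sum H {..<n} \<and>
    walk (g 0) (g (2 * n - 1)) (\<Union>i<2 * n. column z (g i) (H (i div 2))) (lengths z t (2 * n - 1) B (2 * K))"
  using assms(4,1-3)
proof (induction n arbitrary: K rule: nat_induct_non_zero)
  case 1
  have "{..<2 * 1} = {0, 1 :: nat}"
    by auto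
  moreover have T: "traversable t (H 0) K"
    using 1 by simp
  then have "K < H 0"
    by (simp add: traversable_def)
  ultimately show ?case
    using walk_column_pair[OF T, of "g 0" "g 1" z] 1(1)[of 0]
    by (intro exI[of _ "2 * (H 0 - 1 - K)"]) simp
next
  case (Suc n)
  \<comment> \<open>Greedy choice: the last pair takes as many long steps as it may, so the rest
    fits the earlier pairs.\<close>
  define k where "k = min K (cap n)"
  have "K - k \<le> sum cap {..<n}"
    using Suc.prems(3) by (auto simp: k_def)
  then obtain B where B: "B + 2 * (K - k) + 2 * n = 2 * sum H {..<n}"
    and W: "walk (g 0) (g (2 * n - 1)) (\<Union>i<2 * n. column z (g i) (H (i div 2)))
      (lengths z t (2 * n - 1) B (2 * (K - k)))"
    using Suc.IH[of "K - k"] Suc.prems(1,2) by auto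
  have T: "traversable t (H n) k"
    using Suc.prems(2)[of n k] by (simp add: k_def)
  then have kH: "k < H n"
    by (simp add: traversable_def)
  have g: "linear_length (g (2 * n - 1)) (g (2 * n)) = 1" "linear_length (g (2 * n)) (g (2 * n + 1)) = 1"
    using Suc.prems(1)[of "2 * n - 1"] Suc.prems(1)[of "2 * n"] Suc.hyps by simp_all
  have "(\<Union>i<2 * Suc n. column z (g i) (H (i div 2))) = (\<Union>i<2 * n. column z (g i) (H (i div 2))) \<union>
      (column z (g (2 * n)) (H n) \<union> column z (g (2 * n + 1)) (H n))"
    by (auto simp: lessThan_Suc)
  moreover have "Suc (2 * n - 1 + 1) = 2 * Suc n - 1" "2 * (K - k) + 2 * k = 2 * K"
    using Suc.hyps by (auto simp: k_def)
  ultimately have "walk (g 0) (g (2 * Suc n - 1)) (\<Union>i<2 * Suc n. column z (g i) (H (i div 2)))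
      (lengths z t (2 * Suc n - 1) (B + 2 * (H n - 1 - k)) (2 * K))"
    using walk_join[OF W walk_column_pair[OF T g(2), of z]] g(1)
    by (simp only: lengths_add lengths_add_mset) simp
  moreover have "B + 2 * (H n - 1 - k) + 2 * K + 2 * Suc n = 2 * sum H {..<Suc n}"
    using B kH by (simp add: k_def)
  ultimately show ?case
    by blast
qed

lemma walk_column_pairs_single:
  assumes "\<And>i. i < 2 * n \<Longrightarrow> linear_length (g i) (g (Suc i)) = 1"
    and "\<And>m k. m < n \<Longrightarrow> k \<le> cap m \<Longrightarrow> traversable t (H m) k"
    and "K \<le> sum cap {..<n}" "0 < n" "traversable t h k"
  shows "\<exists>B e. B + 2 * K + k + 2 * n + 1 = 2 * sum H {..<n} + h \<and>
    walk (g 0) e ((\<Union>i<2 * n. column z (g i) (H (i div 2))) \<union> column z (g (2 * n)) h)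
      (lengths z t (2 * n) B (2 * K + k))"
proof -
  obtain B where B: "B + 2 * K + 2 * n = 2 * sum H {..<n}"
    and W: "walk (g 0) (g (2 * n - 1)) (\<Union>i<2 * n. column z (g i) (H (i div 2)))
      (lengths z t (2 * n - 1) B (2 * K))"
    using walk_column_pairs[of n g cap t H K z] assms(1-4) by auto
  obtain e where e: "\<And>g. walk g (g + e * z) (column z g h) (lengths z t 0 (h - 1 - k) k)"
    using walk_column[OF assms(5), of z] by blast
  have "linear_length (g (2 * n - 1)) (g (2 * n)) = 1"
    using assms(1)[of "2 * n - 1"] assms(4) by simp
  then have "walk (g 0) (g (2 * n) + e * z)
      ((\<Union>i<2 * n. column z (g i) (H (i div 2))) \<union> column z (g (2 * n)) h)
      (lengths z t (2 * n) (B + (h - 1 - k)) (2 * K + k))"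
    using walk_join[OF W e[of "g (2 * n)"]] assms(4)
    by (simp only: lengths_add lengths_add_mset) simp
  moreover have "k < h"
    using assms(5) by (simp add: traversable_def)
  then have "B + (h - 1 - k) + 2 * K + k + 2 * n + 1 = 2 * sum H {..<n} + h"
    using B by simp
  ultimately show ?thesis
    by blast
qed

section \<open>Orders of the columns with a single change of height\<close>

lemma sum_switch:
  fixes a b :: nat
  assumes "s \<le> n"
  shows "(\<Sum>m<n. if m < s then a else b) = s * a + (n - s) * b"
proof -
  have "{..<n} \<inter> {m. m < s} = {..<s}" "{..<n} \<inter> - {m. m < s} = {s..<n}"
    using assms by auto
  then show ?thesis
    by (simp add: sum.If_cases)
qed

lemma sum_switch_Suc:
  fixes q :: nat
  assumes "s \<le> n"
  shows "(\<Sum>m<n. if m < s then q else q + 1) + s = n * q + n"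
proof -
  obtain j where "n = s + j"
    using assms le_Suc_ex by blast
  then show ?thesis
    using sum_switch[OF assms, of q "q + 1"] by (simp add: algebra_simps)
qed

text \<open>In the next lemmas the residue classes are visited in the order \<open>0, 1, \<dots>, z - 1\<close>.\<close>

lemma rising_column_cover:
  assumes "u < q * z + r" "r = 2 * s" "r \<le> z" "z > 0"
  shows "u \<in> column z (u mod z) (if u mod z div 2 < s then q + 1 else q)"
proof (rule columnI)
  show "u = u mod z + u div z * z"
    by simp
  have "u < Suc q * z"
    using assms(1,3) by simp
  then have "u div z < Suc q"
    by (rule less_mult_imp_div_less)
  moreover have "u div z < q" if "u mod z \<ge> r"
  proof (rule ccontr)
    assume "\<not> u div z < q"
    then have "q * z \<le> u div z * z"
      by simp
    then show False
      using that assms(1) div_mult_mod_eq[of u z] by linarith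
  qed
  ultimately show "u div z < (if u mod z div 2 < s then q + 1 else q)"
    using assms(2) by (auto simp: not_less)
qed

text \<open>The first \<open>r\<close> columns are one higher than the others. Since
  \<open>r\<close> is even, this change of height falls between two pairs.\<close>

lemma rising_even:
  assumes "z = 2 * n" "n > 0" "r = 2 * s" "s \<le> n" "q > 0"
    and "z - 1 + d + 1 = q * z + r"
  shows "has_standard_linear_realization (replicate_mset (z - 1) 1 + replicate_mset d z)"
proof -
  let ?H = "\<lambda>m. if m < s then q + 1 else q"
  have "linear_length i (Suc i) = 1" for i
    by (simp add: linear_length_def)
  then obtain B where B: "B + 2 * 0 + 2 * n = 2 * sum ?H {..<n}"
    and W: "walk 0 (2 * n - 1) (\<Union>i<2 * n. column z i (?H (i div 2))) (lengths z 1 (2 * n - 1) B (2 * 0))"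
    using walk_column_pairs[of n "\<lambda>i. i" "\<lambda>_. 0" 1 ?H 0 z] assms(2,5) traversable_0 by auto
  have "sum ?H {..<n} = n * q + s"
    using sum_switch[OF assms(4), of "q + 1" q] assms(4) by (simp add: algebra_simps flip: distrib_right)
  then have "B = d"
    using B assms by (simp add: algebra_simps)
  moreover have "u \<in> (\<Union>i<2 * n. column z i (?H (i div 2)))" if "u \<le> size (lengths z 1 (2 * n - 1) d 0)" for u
  proof -
    have "u < q * z + r"
      using that assms by (simp add: size_lengths)
    moreover have "u mod z < 2 * n"
      using assms by simp
    ultimately show ?thesis
      using rising_column_cover[of u q z r s] assms(1-4) by (intro UN_I[of "u mod z"]) auto
  qed
  ultimately have "has_standard_linear_realization (lengths z 1 (2 * n - 1) d 0)"
    using W by (intro standard_realization_if_walk) auto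
  then show ?thesis
    using assms(1) by (simp add: lengths_def)
qed

text \<open>As \<open>r \<le> 2 * n\<close>, the unpaired last column is one of the low ones, of
  height \<open>q\<close>.\<close>

lemma rising_odd:
  assumes "z = 2 * n + 1" "n > 0" "r = 2 * s" "s \<le> n"
    and "2 * n + b + 2 * K + k + 1 = q * z + r"
    and "\<And>k. k \<le> y' \<Longrightarrow> traversable t (q + 1) k" "\<And>k. k \<le> y \<Longrightarrow> traversable t q k"
    and "K \<le> s * y' + (n - s) * y" "traversable t q k"
  shows "has_standard_linear_realization (lengths z t (2 * n) b (2 * K + k))"
proof -
  let ?H = "\<lambda>m. if m < s then q + 1 else q"
  let ?cap = "\<lambda>m. if m < s then y' else y"
  have "K \<le> sum ?cap {..<n}"
    using sum_switch[OF assms(4), of y' y] assms(8) by simp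
  have "\<exists>B e. B + 2 * K + k + 2 * n + 1 = 2 * sum ?H {..<n} + q \<and>
    walk 0 e ((\<Union>i<2 * n. column z i (?H (i div 2))) \<union> column z (2 * n) q)
      (lengths z t (2 * n) B (2 * K + k))"
    by (rule walk_column_pairs_single[where g = "\<lambda>i. i" and cap = ?cap])
      (use assms(2,6,7,9) \<open>K \<le> sum ?cap {..<n}\<close> in \<open>auto simp: linear_length_def split: if_splits\<close>)
  then obtain B e where B: "B + 2 * K + k + 2 * n + 1 = 2 * sum ?H {..<n} + q"
    and W: "walk 0 e ((\<Union>i<2 * n. column z i (?H (i div 2))) \<union> column z (2 * n) q)
      (lengths z t (2 * n) B (2 * K + k))"
    by blast
  have "sum ?H {..<n} = n * q + s"
    using sum_switch[OF assms(4), of "q + 1" q] assms(4) by (simp add: algebra_simps flip: distrib_right)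
  then have "B = b"
    using B assms(1,3,5) by (simp add: algebra_simps)
  moreover have "u \<in> (\<Union>i<2 * n. column z i (?H (i div 2))) \<union> column z (2 * n) q"
    if "u \<le> size (lengths z t (2 * n) b (2 * K + k))" for u
  proof -
    have "u < q * z + r"
      using that assms(5) by (simp add: size_lengths)
    then have u: "u \<in> column z (u mod z) (?H (u mod z div 2))"
      using assms(1,3,4) by (intro rising_column_cover) auto
    have "u mod z < 2 * n + 1"
      using assms(1) by simp
    then consider "u mod z < 2 * n" | "u mod z = 2 * n"
      by linarith
    then show ?thesis
    proof cases
      case 1
      then show ?thesis
        using u by (intro UnI1 UN_I[of "u mod z"]) simp_all
    next
      case 2
      then show ?thesis
        using u assms(4) by simp
    qed
  qed
  ultimately show ?thesis
    using W by (intro standard_realization_if_walk) auto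
qed

text \<open>In the next lemmas \<open>0\<close> is followed by \<open>z\<close>, and the residue classes of the remaining
  vertices are visited in the order \<open>z, z - 1, \<dots>, 1\<close>. In this numbering
  the class of \<open>0\<close> loses its lowest vertex and the heights again switch only once.\<close>

lemma standard_realization_if_walk_from:
  assumes "walk z e A L" "{1..size L + 1} \<subseteq> A"
  shows "has_standard_linear_realization (add_mset z L)"
proof (rule standard_realization_if_walk)
  show "walk 0 e ({0} \<union> A) (add_mset z L)"
    using walk_join[OF walk_single[of 0] assms(1)] by (simp add: linear_length_def)
  show "{..size (add_mset z L)} \<subseteq> {0} \<union> A"
  proof
    fix u assume "u \<in> {..size (add_mset z L)}"
    then have "u = 0 \<or> u \<in> {1..size L + 1}"
      by auto
    then show "u \<in> {0} \<union> A"
      using assms(2) by blast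
  qed
qed

lemma falling_column_cover:
  assumes "0 < u" "u < q * z + r" "1 \<le> r" "r \<le> z"
  obtains i where "i < z" "u \<in> column z (z - i) (if i \<le> z - r then q else q + 1)"
proof
  \<comment> \<open>The bottom vertices of the columns are \<open>1, ..., z\<close>, hence the shift
    by one before dividing.\<close>
  define g where "g = Suc ((u - 1) mod z)"
  define j where "j = (u - 1) div z"
  have z: "z > 0"
    using assms by simp
  then have g: "1 \<le> g" "g \<le> z"
    using mod_less_divisor[OF z, of "u - 1"] by (auto simp: g_def)
  have "u - 1 = j * z + (u - 1) mod z"
    by (simp add: j_def)
  then have u: "u = g + j * z"
    using assms(1) unfolding g_def by linarith
  show "z - g < z"
    using g by simp
  have "u - 1 < Suc q * z"
    using assms by simp
  then have "j < Suc q"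
    unfolding j_def by (rule less_mult_imp_div_less)
  moreover have "j < q" if "z - g \<le> z - r"
  proof (rule ccontr)
    assume "\<not> j < q"
    then have "q * z \<le> j * z"
      by simp
    moreover have "r \<le> g"
      using that g assms(4) by linarith
    ultimately show False
      using u assms(2) by linarith
  qed
  ultimately have "j < (if z - g \<le> z - r then q else q + 1)"
    by simp
  then show "u \<in> column z (z - (z - g)) (if z - g \<le> z - r then q else q + 1)"
    using u g by (intro columnI) auto
qed

lemma linear_length_falling: "Suc i \<le> z \<Longrightarrow> linear_length (z - i) (z - Suc i) = 1"
  unfolding linear_length_def by linarith

text \<open>The columns \<open>z, ..., r\<close> have height \<open>q\<close> and come first. Their
  number \<open>z - r + 1 = 2 * s\<close> is even for odd \<open>r\<close>, so the change of height
  again falls between two pairs.\<close>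

lemma falling_even:
  assumes "z = 2 * n" "n > 0" "r + 2 * s = z + 1" "s \<le> n" "s > 0" "q > 0"
    and "z - 1 + d + 1 = q * z + r"
  shows "has_standard_linear_realization (replicate_mset (z - 1) 1 + replicate_mset d z)"
proof -
  have step: "linear_length (z - i) (z - Suc i) = 1" if "i < 2 * n" for i
    using that assms(1) by (intro linear_length_falling) simp
  let ?H = "\<lambda>m. if m < s then q else q + 1"
  have "\<exists>B. B + 2 * 0 + 2 * n = 2 * sum ?H {..<n} \<and>
    walk (z - 0) (z - (2 * n - 1)) (\<Union>i<2 * n. column z (z - i) (?H (i div 2)))
      (lengths z 1 (2 * n - 1) B (2 * 0))"
    by (rule walk_column_pairs[where g = "\<lambda>i. z - i" and cap = "\<lambda>_. 0"])
      (use step assms(2,6) in \<open>auto intro: traversable_0\<close>)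
  then obtain B where B: "B + 2 * n = 2 * sum ?H {..<n}"
    and W: "walk z (z - (2 * n - 1)) (\<Union>i<2 * n. column z (z - i) (?H (i div 2)))
      (lengths z 1 (2 * n - 1) B 0)"
    by auto
  have "sum ?H {..<n} + s = n * q + n"
    using sum_switch_Suc[OF assms(4)] .
  \<comment> \<open>The additional edge of length \<open>z\<close> is the first one, from 0 to
    \<open>z\<close>.\<close>
  then have d: "B + 1 = d"
    using B assms by (simp add: algebra_simps)
  have "u \<in> (\<Union>i<2 * n. column z (z - i) (?H (i div 2)))"
    if "u \<in> {1..size (lengths z 1 (2 * n - 1) B 0) + 1}" for u
  proof -
    have u: "0 < u" "u < q * z + r"
      using that assms d by (auto simp: size_lengths)
    have r: "1 \<le> r" "r \<le> z"
      using assms(1,3-5) by linarith+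
    obtain i where i: "i < z" "u \<in> column z (z - i) (if i \<le> z - r then q else q + 1)"
      using falling_column_cover[OF u r] .
    have "i \<le> z - r \<longleftrightarrow> i div 2 < s"
      using assms(3) r by presburger
    then show ?thesis
      using i assms(1) by (intro UN_I[of i]) auto
  qed
  then have "has_standard_linear_realization (add_mset z (lengths z 1 (2 * n - 1) B 0))"
    by (intro standard_realization_if_walk_from[OF W]) blast
  then show ?thesis
    using assms(1) by (simp only: lengths_add_mset) (simp add: lengths_def flip: d)
qed

text \<open>For remainder 1, removing the vertex 0 leaves all \<open>z\<close> columns with the same
  height \<open>q\<close>.\<close>

lemma falling_odd:
  assumes "z = 2 * n + 1" "n > 0"
    and "2 * n + b + 2 * K + k + 1 = q * z + 1"
    and "\<And>k. k \<le> y \<Longrightarrow> traversable t q k" "K \<le> n * y" "traversable t q k"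
  shows "has_standard_linear_realization (lengths z t (2 * n) b (2 * K + k))"
proof -
  have step: "linear_length (z - i) (z - Suc i) = 1" if "i < 2 * n" for i
    using that assms(1) by (intro linear_length_falling) simp
  have "\<exists>B e. B + 2 * K + k + 2 * n + 1 = 2 * sum (\<lambda>_. q) {..<n} + q \<and>
    walk (z - 0) e ((\<Union>i<2 * n. column z (z - i) q) \<union> column z (z - 2 * n) q)
      (lengths z t (2 * n) B (2 * K + k))"
    by (rule walk_column_pairs_single[where g = "\<lambda>i. z - i" and cap = "\<lambda>_. y"])
      (use step assms(2,4-6) in \<open>auto\<close>)
  then obtain B e where B: "B + 2 * K + k + 2 * n + 1 = 2 * (n * q) + q"
    and W: "walk z e ((\<Union>i<2 * n. column z (z - i) q) \<union> column z (z - 2 * n) q)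
      (lengths z t (2 * n) B (2 * K + k))"
    by auto
  have b: "Suc B = b"
    using B assms(1,3) by (simp add: algebra_simps)
  have "u \<in> (\<Union>i<2 * n. column z (z - i) q) \<union> column z (z - 2 * n) q"
    if "u \<in> {1..size (lengths z t (2 * n) B (2 * K + k)) + 1}" for u
  proof -
    have u: "0 < u" "u < q * z + 1"
      using that assms b by (auto simp: size_lengths)
    obtain i where i: "i < z" "u \<in> column z (z - i) (if i \<le> z - 1 then q else q + 1)"
      using falling_column_cover[OF u] assms(1) by auto
    then have "u \<in> column z (z - i) q" "i < 2 * n \<or> i = 2 * n"
      using assms(1) by auto
    then show ?thesis
      by blast
  qed
  then have "has_standard_linear_realization (add_mset z (lengths z t (2 * n) B (2 * K + k)))"
    by (intro standard_realization_if_walk_from[OF W]) blast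
  then show ?thesis
    by (simp only: lengths_add_mset b)
qed

text \<open>One additional step of length 1 is spent on the last three columns, which are visited in the
  order 3, 2, 1, 2, only the top vertex of column 2 being used the first time.\<close>

lemma falling_hook:
  assumes "z = 2 * n + 3" "n > 0" "r + 2 * s = z + 1" "4 \<le> r" "s > 0" "q > 0"
    and "z + b + 2 * K + k + 1 = q * z + r"
    and "\<And>k. k \<le> y \<Longrightarrow> traversable t q k" "\<And>k. k \<le> y' \<Longrightarrow> traversable t (q + 1) k"
    and "K \<le> s * y + (n - s) * y'" "traversable t q k"
  shows "has_standard_linear_realization (lengths z t z b (2 * K + k))"
proof -
  have step: "linear_length (z - i) (z - Suc i) = 1" if "i < 2 * n" for i
    using that assms(1) by (intro linear_length_falling) simp
  let ?H = "\<lambda>m. if m < s then q else q + 1"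
  let ?cap = "\<lambda>m. if m < s then y else y'"
  have sn: "s \<le> n"
    using assms(1,3,4) by linarith
  have "K \<le> sum ?cap {..<n}"
    using sum_switch[OF sn, of y y'] assms(10) by simp
  have "\<exists>B. B + 2 * K + 2 * n = 2 * sum ?H {..<n} \<and>
    walk (z - 0) (z - (2 * n - 1)) (\<Union>i<2 * n. column z (z - i) (?H (i div 2)))
      (lengths z t (2 * n - 1) B (2 * K))"
    by (rule walk_column_pairs[where g = "\<lambda>i. z - i" and cap = ?cap])
      (use step assms(2,8,9) \<open>K \<le> sum ?cap {..<n}\<close> in \<open>auto split: if_splits\<close>)
  moreover have "z - (2 * n - 1) = 4"
    using assms(1,2) by simp
  ultimately obtain B where B: "B + 2 * K + 2 * n = 2 * sum ?H {..<n}"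
    and W: "walk z 4 (\<Union>i<2 * n. column z (z - i) (?H (i div 2))) (lengths z t (2 * n - 1) B (2 * K))"
      (is "walk z 4 ?A _")
    by auto
  have sum: "sum ?H {..<n} + s = n * q + n"
    using sum_switch_Suc[OF sn] .
  obtain e where e: "walk 2 (2 + e * z) (column z 2 q) (lengths z t 0 (q - 1 - k) k)"
    using walk_column[OF assms(11), of z] by blast
  have straight: "walk 3 (3 + q * z) (column z 3 (q + 1)) (lengths z t 0 q 0)"
      "walk (1 + q * z) 1 (column z 1 (q + 1)) (lengths z t 0 q 0)"
    using walk_column_straight[of "q + 1" 3 z t] walk_column_straight[of "q + 1" 1 z t] by simp_all
  have ll: "linear_length 4 3 = 1" "linear_length (3 + q * z) (2 + q * z) = 1"
      "linear_length (2 + q * z) (1 + q * z) = 1" "linear_length 1 2 = 1"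
    by (simp_all add: linear_length_def)
  have "{#} = lengths z t 0 0 0"
    by (simp add: lengths_def)
  note top = walk_single[of "2 + q * z", unfolded this]
  have "walk z (2 + e * z)
      (((((?A \<union> column z 3 (q + 1)) \<union> {2 + q * z}) \<union> column z 1 (q + 1))) \<union> column z 2 q)
      (lengths z t (Suc (Suc (Suc (Suc (2 * n - 1))))) (B + q + q + (q - 1 - k)) (2 * K + k))"
    \<comment> \<open>Up column 3, across the top of column 2 to the top of column 1, down column 1,
      and back to column 2 for its lower \<open>q\<close> vertices.\<close>
    using walk_join[OF walk_join[OF walk_join[OF walk_join[OF W straight(1)] top] straight(2)] e]
    by (simp only: ll lengths_add lengths_add_mset) simp
  \<comment> \<open>The pairs use \<open>2 * n - 1\<close> edges of length 1 and the last three
    columns four more.\<close>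
  moreover have "Suc (Suc (Suc (Suc (2 * n - 1)))) = z"
    using assms(1,2) by simp
  ultimately have W': "walk z (2 + e * z)
      (((((?A \<union> column z 3 (q + 1)) \<union> {2 + q * z}) \<union> column z 1 (q + 1))) \<union> column z 2 q)
      (lengths z t z (B + q + q + (q - 1 - k)) (2 * K + k))" (is "walk z _ ?A' _")
    by simp
  have "k < q"
    using assms(11) by (simp add: traversable_def)
  moreover have "q * z = 2 * (n * q) + 3 * q"
    using assms(1) by (simp add: algebra_simps)
  ultimately have b: "Suc (B + q + q + (q - 1 - k)) = b"
    using B sum assms(1,3,7) by linarith
  have "u \<in> ?A'" if "u \<in> {1..size (lengths z t z (B + q + q + (q - 1 - k)) (2 * K + k)) + 1}" for u
  proof -
    have "u \<le> z + Suc (B + q + q + (q - 1 - k)) + (2 * K + k)" "0 < u"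
      using that by (auto simp: size_lengths)
    then have u: "0 < u" "u < q * z + r"
      using assms(7) unfolding b by linarith+
    have r: "1 \<le> r" "r \<le> z"
      using assms(3-5) by linarith+
    obtain i where i: "i < z" "u \<in> column z (z - i) (if i \<le> z - r then q else q + 1)"
      using falling_column_cover[OF u r] .
    have s: "i \<le> z - r \<longleftrightarrow> i div 2 < s"
      using assms(3) r by presburger
    have low: "u \<in> ?A" if "i < 2 * n"
      using i s that by (intro UN_I[of i]) auto
    \<comment> \<open>Because \<open>4 \<le> r\<close>, the columns 3, 2 and 1 all have height
      \<open>q + 1\<close>.\<close>
    have high: "u \<in> column z (z - i) (q + 1)" if "\<not> i < 2 * n"
    proof -
      have "\<not> i \<le> z - r"
        using that assms(1,2,4) by linarith
      then show ?thesis
        using i(2) by simp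
    qed
    have top: "column z 2 (q + 1) \<subseteq> column z 2 q \<union> {2 + q * z}"
      by (auto simp: column_def lessThan_Suc)
    consider "i < 2 * n" | "\<not> i < 2 * n" "z - i = 3" | "\<not> i < 2 * n" "z - i = 2" | "\<not> i < 2 * n" "z - i = 1"
      using i(1) assms(1) by linarith
    then show ?thesis
    proof cases
      case 1
      then show ?thesis
        using low by blast
    next
      case 2
      then show ?thesis
        using high by simp
    next
      case 3
      then have "u \<in> column z 2 q \<union> {2 + q * z}"
        using high top by auto
      then show ?thesis
        by blast
    next
      case 4
      then show ?thesis
        using high by simp
    qed
  qed
  then have "has_standard_linear_realization
      (add_mset z (lengths z t z (B + q + q + (q - 1 - k)) (2 * K + k)))"
    by (intro standard_realization_if_walk_from[OF W']) blast
  then show ?thesis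
    by (simp only: lengths_add_mset b)
qed

text \<open>The sweeps without long steps, with \<open>t\<close> as the column distance. This serves
  twice: it makes columns traversable, and it shows that the minimum in \<open>omega\<close>
  exists.\<close>

lemma standard_realization_ones:
  assumes "t \<ge> 2" "k > 0"
  shows "has_standard_linear_realization (replicate_mset t 1 + replicate_mset k t)"
proof -
  define q where "q = (t + k) div t"
  define r where "r = (t + k) mod t"
  have qr: "t + k = q * t + r" "q > 0" "r < t"
    using assms by (simp_all add: q_def r_def div_greater_zero_iff del: mod_add_self1 div_add_self1)
  have k: "t - 1 + k + 1 = q * t + r"
    using qr assms by simp
  have T: "traversable 1 q 0" "traversable 1 (q + 1) 0"
    using qr by (simp_all add: traversable_0)
  show ?thesis
  proof (cases "even t \<or> even r \<or> r = 1")
    case True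
    have "has_standard_linear_realization (replicate_mset (t - 1) 1 + replicate_mset k t)"
    proof (cases "even t")
      case t: True
      then obtain n where n: "t = 2 * n"
        by (elim evenE)
      show ?thesis
      proof (cases "even r")
        case True
        then obtain s where "r = 2 * s"
          by (elim evenE)
        then show ?thesis
          using rising_even[of t n r s q k] n k qr assms by simp
      next
        case False
        \<comment> \<open>Half the number \<open>t - r + 1\<close> of low columns.\<close>
        then have "r + 2 * (n - r div 2) = t + 1" "n - r div 2 \<le> n" "n - r div 2 > 0"
          using n qr(3) by presburger+
        then show ?thesis
          using falling_even[of t n r "n - r div 2" q k] n k qr assms by simp
      qed
    next
      case t: False
      then obtain n where n: "t = 2 * n + 1"
        by (elim oddE)
      have n': "n > 0"
        using n assms by simp
      have "has_standard_linear_realization (lengths t 1 (2 * n) k (2 * 0 + 0))"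
      proof (cases "r = 1")
        case True
        then show ?thesis
          using n n' k T by (intro falling_odd[where y = 0]) auto
      next
        case False
        then obtain s where "r = 2 * s"
          using True t by (auto elim: evenE)
        then show ?thesis
          using n n' k T qr(3) by (intro rising_odd[where y = 0 and y' = 0 and s = s and q = q]) auto
      qed
      then show ?thesis
        using n by (simp add: lengths_def)
    qed
    then show ?thesis
      using standard_realization_mono by force
  next
    case False
    then obtain n where n: "t = 2 * n + 1"
      by (auto elim: oddE)
    have r: "odd r" "3 \<le> r" "r + 2 \<le> t"
      using False qr(3) by presburger+
    \<comment> \<open>The extra edge of length 1 adds a vertex, so the remainder becomes the even
      number \<open>r + 1\<close>, which is at least 4 and less than \<open>t\<close>.\<close>
    define s where "s = (t - r) div 2"
    have s: "r + 1 + 2 * s = t + 1" "s > 0"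
      using r n unfolding s_def by presburger+
    have "has_standard_linear_realization (lengths t 1 t k (2 * 0 + 0))"
      using n r s k T qr(2)
      by (intro falling_hook[where n = "n - 1" and r = "r + 1" and s = s and q = q and y = 0 and y' = 0]) auto
    then show ?thesis
      by (simp add: lengths_def)
  qed
qed

section \<open>Heights that make a column traversable\<close>

lemma traversable_if_large:
  assumes "t \<ge> 2" "k + t + 1 \<le> h"
  shows "traversable t h k"
proof (cases "k = 0")
  case True
  then show ?thesis
    using assms by (simp add: traversable_0)
next
  case False
  then have "has_standard_linear_realization (replicate_mset (h - 1 - k) 1 + replicate_mset k t)"
    using standard_realization_mono[OF standard_realization_ones, of t k "h - 1 - k"] assms by simp
  then show ?thesis
    using assms by (simp add: traversable_def)
qed

text \<open>The path \<open>0, t, t - 1, ..., 1\<close> has a single edge of length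
  \<open>t\<close>. It allows a parity correction in a column too low for
  \<open>traversable_if_large\<close>.\<close>

lemma traversable_1:
  assumes "t > 0" "t + 1 \<le> h"
  shows "traversable t h 1"
proof -
  have "walk 0 1 ({0} \<union> column 1 1 t) (add_mset t (lengths 1 1 0 (t - 1) 0))"
    using walk_join[OF walk_single[of 0] walk_column_straight(2)[OF assms(1), of 1 1 1]] assms(1)
    by (simp add: linear_length_def)
  moreover have "{..t} \<subseteq> {0} \<union> column 1 1 t"
  proof
    fix u assume "u \<in> {..t}"
    then show "u \<in> {0} \<union> column 1 1 t"
      using columnI[of "u - 1" t u 1 1] by (cases u) auto
  qed
  ultimately have "has_standard_linear_realization (add_mset t (lengths 1 1 0 (t - 1) 0))"
    using assms(1) by (intro standard_realization_if_walk) (simp_all add: size_lengths)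
  then have "has_standard_linear_realization (replicate_mset (t - 1) 1 + replicate_mset 1 t)"
    by (simp add: lengths_def)
  from standard_realization_mono[OF this, of "h - 1 - 1"] show ?thesis
    using assms by (simp add: traversable_def)
qed

section \<open>Three edge lengths\<close>

text \<open>\<open>S\<close> is the capacity of the pairs and \<open>M\<close> that of the single
  column; the alternative \<open>k = 1\<close> settles the parity even for
  \<open>M = 0\<close>.\<close>

lemma split_even_part:
  fixes c :: nat
  assumes "c \<le> 2 * S + M"
  obtains K k where "K \<le> S" "c = 2 * K + k" "k \<le> M \<or> k = 1"
proof (cases "c \<le> 2 * S")
  case True
  then have "c div 2 \<le> S" "c = 2 * (c div 2) + c mod 2" "c mod 2 \<le> M \<or> c mod 2 = 1"
    by auto
  then show ?thesis
    by (rule that)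
next
  case False
  then have "S \<le> S" "c = 2 * S + (c - 2 * S)" "c - 2 * S \<le> M \<or> c - 2 * S = 1"
    using assms by auto
  then show ?thesis
    by (rule that)
qed

lemma omega_realization:
  assumes "z \<ge> 2" "d > 0"
  shows "has_standard_linear_realization (replicate_mset (omega z d) 1 + replicate_mset d z)"
  unfolding omega_def
  by (rule LeastI[where P = "\<lambda>a. has_standard_linear_realization (replicate_mset a 1 + replicate_mset d z)",
        OF standard_realization_ones[OF assms]])

lemma fewest_ones_realization:
  assumes "odd x" "x > 1" "t \<ge> 2" "v = x - 1 + b + c + 1"
    and "v = q * x + r" "r < x" "even r \<or> r = 1" "q = t + 1 + y"
    and "2 * q + t * x + 1 \<le> b + 2 * t"
  shows "has_standard_linear_realization (lengths x t (x - 1) b c)"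
proof -
  obtain n where n: "x = 2 * n + 1"
    using assms(1) by (elim oddE)
  then have n': "n > 0"
    using assms(2) by simp
  \<comment> \<open>The lower bound on \<open>b\<close> becomes an upper bound on \<open>c\<close>,
    to be compared with the total capacity for long steps: \<open>y\<close> for a column of height
    \<open>q\<close> and \<open>y + 1\<close> for one of height \<open>q + 1\<close>.\<close>
  have "b + c = t * x + y * x + r"
    using assms(2,4,5,8) by (simp add: algebra_simps)
  moreover have "2 * y + t * x + 3 \<le> b"
    using assms(8,9) by simp
  ultimately have "c + 2 * y + 3 \<le> y * x + r"
    by linarith
  then have c: "c + y + 3 \<le> 2 * (n * y) + r"
    using n by (simp add: algebra_simps)
  have T: "traversable t q k" if "k \<le> y \<or> k = 1" for k
  proof (cases "k \<le> y")
    case True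
    then show ?thesis
      using assms(3,8) by (intro traversable_if_large) auto
  next
    case False
    then show ?thesis
      using that assms(3,8) traversable_1[of t q] by simp
  qed
  have T': "traversable t (q + 1) k" if "k \<le> y + 1" for k
    using that assms(3,8) by (intro traversable_if_large) auto
  show ?thesis
  proof (cases "r = 1")
    case True
    have "c \<le> 2 * (n * y) + y"
      using c True by linarith
    then obtain K k where K: "K \<le> n * y" "c = 2 * K + k" "k \<le> y \<or> k = 1"
      by (rule split_even_part)
    have "has_standard_linear_realization (lengths x t (2 * n) b (2 * K + k))"
      using n n' K T assms(4,5) True by (intro falling_odd[where y = y and q = q]) auto
    then show ?thesis
      using K n by simp
  next
    case False
    then obtain s where s: "r = 2 * s"
      using assms(7) by (auto elim: evenE)
    have sn: "s \<le> n"
      using s n assms(6) by simp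
    obtain j where j: "n = s + j"
      using sn le_Suc_ex by blast
    have "c \<le> 2 * (s * (y + 1) + (n - s) * y) + y"
      using c s by (simp add: j algebra_simps)
    then obtain K k where K: "K \<le> s * (y + 1) + (n - s) * y" "c = 2 * K + k" "k \<le> y \<or> k = 1"
      by (rule split_even_part)
    have "has_standard_linear_realization (lengths x t (2 * n) b (2 * K + k))"
      using n n' K T T' s sn assms(4,5)
      by (intro rising_odd[where y = y and y' = "y + 1" and q = q and s = s and r = r]) auto
    then show ?thesis
      using K n by simp
  qed
qed

lemma one_more_realization:
  assumes "odd x" "t \<ge> 2" "v = x + b + c + 1"
    and "v = q * x + r" "r < x" "even r" "4 \<le> r" "q = t + 1 + y"
    and "2 * q + t * x + 1 \<le> b + 2 * t"
  shows "has_standard_linear_realization (lengths x t x b c)"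
proof -
  obtain n where "x = 2 * n + 1"
    using assms(1) by (elim oddE)
  then have "x = 2 * (n - 1) + 3" "n - 1 > 0"
    using assms(5,7) by simp_all
  then obtain n where n: "x = 2 * n + 3" "n > 0"
    by blast
  define s where "s = (x + 1 - r) div 2"
  have s: "r + 2 * s = x + 1" "s > 0"
    using assms(1,5,6) unfolding s_def by presburger+
  have sn: "s \<le> n"
    using s(1) n(1) assms(7) by linarith
  have "b + c + 1 = t * x + y * x + r"
    using assms(3,4,8) by (simp add: algebra_simps)
  moreover have "2 * y + t * x + 3 \<le> b"
    using assms(8,9) by simp
  ultimately have "c + 2 * y + 4 \<le> y * x + r"
    by linarith
  then have "c + 4 \<le> 2 * (n * y) + y + r"
    using n by (simp add: algebra_simps)
  \<comment> \<open>As \<open>r + 2 * s = 2 * n + 4\<close>, this is exactly the capacity of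
    \<open>s\<close> low pairs, \<open>n - s\<close> high pairs and a single low column.\<close>
  then have c: "c + 2 * s \<le> 2 * (n * y) + 2 * n + y"
    using s n by linarith
  have T: "traversable t q k" if "k \<le> y \<or> k = 1" for k
  proof (cases "k \<le> y")
    case True
    then show ?thesis
      using assms(2,8) by (intro traversable_if_large) auto
  next
    case False
    then show ?thesis
      using that assms(2,8) traversable_1[of t q] by simp
  qed
  have T': "traversable t (q + 1) k" if "k \<le> y + 1" for k
    using that assms(2,8) by (intro traversable_if_large) auto
  obtain j where j: "n = s + j"
    using sn le_Suc_ex by blast
  have "c \<le> 2 * (s * y + (n - s) * (y + 1)) + y"
    using c by (simp add: j algebra_simps)
  then obtain K k where K: "K \<le> s * y + (n - s) * (y + 1)" "c = 2 * K + k" "k \<le> y \<or> k = 1"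
    by (rule split_even_part)
  have "has_standard_linear_realization (lengths x t x b (2 * K + k))"
    using n K T T' s assms(3,4,7,8)
    by (intro falling_hook[where y = y and y' = "y + 1" and q = q and s = s and r = r and n = n]) auto
  then show ?thesis
    using K by simp
qed

theorem theorem4p3:
  fixes x t a b c v q :: nat and L :: "nat multiset"
  assumes "odd x" and "x > 1" and "t \<ge> 2" and "b + c \<ge> 1"
    and "L = replicate_mset a 1 + replicate_mset b x + replicate_mset c (t * x)"
    and "v = a + b + c + 1"
    and "v \<ge> (t + 2) * x"
    and "q = v div x"
    and "a \<ge> omega x (b + c)"
    and "int b \<ge> 2 * int q + int t * int x - 2 * int t + 1"
  shows "has_standard_linear_realization L"
proof -
  let ?d = "b + c"
  have bq: "2 * q + t * x + 1 \<le> b + 2 * t"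
    using assms(10) by (simp flip: of_nat_mult)
  have "t + 2 \<le> q"
    using div_le_mono[OF assms(7), of x] assms(2,8) by simp
  then have tx: "t * x + 5 \<le> b"
    using bq by linarith
  have "x \<le> t * x"
    using assms(3) by simp
  then have xd: "x \<le> ?d"
    using tx by linarith
  have om: "has_standard_linear_realization (replicate_mset (omega x ?d) 1 + replicate_mset ?d x)"
    using assms(2,4) by (intro omega_realization) auto
  then have "x - 1 \<le> omega x ?d"
    using assms(2) xd by (intro ones_lower_bound) auto
  then have a: "x - 1 \<le> a"
    using assms(9) by simp
  \<comment> \<open>The construction is carried out on \<open>w \<le> v\<close> vertices, with few
    edges of length 1. Its quotient is still at least \<open>t + 1\<close> because \<open>b\<close>
    exceeds \<open>t * x\<close>, and it is at most \<open>q\<close>, so the bound on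
    \<open>b\<close> carries over.\<close>
  have quotient: "\<exists>y. w div x = t + 1 + y" "2 * (w div x) + t * x + 1 \<le> b + 2 * t"
    if "x + ?d \<le> w" "w \<le> v" for w
  proof -
    have "(t + 1) * x \<le> w"
      using that(1) tx by simp
    then have "t + 1 \<le> w div x"
      using div_le_mono[of "(t + 1) * x" w x] assms(2) by simp
    then show "\<exists>y. w div x = t + 1 + y"
      by (rule le_Suc_ex)
    have "w div x \<le> q"
      using that(2) assms(8) div_le_mono by blast
    then show "2 * (w div x) + t * x + 1 \<le> b + 2 * t"
      using bq by linarith
  qed
  show ?thesis
  proof (cases "even (?d mod x) \<or> ?d mod x = 1")
    case True
    \<comment> \<open>The number of vertices when only \<open>x - 1\<close> edges of length 1 are
      used; the surplus is put in front afterwards.\<close>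
    let ?w = "x + ?d"
    have "?w \<le> v"
      using a assms(6) by linarith
    then obtain y where y: "?w div x = t + 1 + y" "2 * (?w div x) + t * x + 1 \<le> b + 2 * t"
      using quotient[of ?w] by auto
    have "?w = (t + 1 + y) * x + ?d mod x"
      using div_mult_mod_eq[of ?w x] unfolding y(1) by simp
    then have "has_standard_linear_realization (lengths x t (x - 1) b c)"
      using assms(1-3) True y(2) unfolding y(1)
      by (intro fewest_ones_realization[where v = ?w and q = "t + 1 + y" and r = "?d mod x"]) simp_all
    then have "has_standard_linear_realization
        (replicate_mset (x - 1) 1 + (replicate_mset b x + replicate_mset c (t * x)))"
      by (simp add: lengths_def add.assoc)
    from standard_realization_mono[OF this a] show ?thesis
      by (simp add: assms(5) add.assoc)
  next
    case False
    let ?r = "?d mod x"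
    have "3 \<le> i" if "odd i" "i \<noteq> 1" for i :: nat
      using that by presburger
    then have r: "odd ?r" "3 \<le> ?r"
      using False by auto
    \<comment> \<open>Otherwise the realization attaining \<open>omega x ?d\<close> could be padded
      to one with \<open>x - 1\<close> edges of length 1, which is impossible here.\<close>
    have "\<not> omega x ?d \<le> x - 1"
      using no_realization_with_fewest_ones[OF assms(1) r xd] standard_realization_mono[OF om] by blast
    then have a': "x \<le> a"
      using assms(9) by linarith
    \<comment> \<open>By parity \<open>?r + 1\<close> differs from \<open>x\<close>, so the extra
      vertex does not complete a row and the remainder simply grows by one.\<close>
    have "even (?r + 1)"
      using r(1) by simp
    then have "?r + 1 \<noteq> x"
      using assms(1) by metis
    moreover have "?r < x"
      using assms(2) by simp
    ultimately have rx: "?r + 1 < x"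
      by linarith
    let ?w = "x + ?d + 1"
    have w: "?w mod x = ?r + 1"
      using rx by (simp add: mod_Suc)
    have "?w \<le> v"
      using a' assms(6) by linarith
    then obtain y where y: "?w div x = t + 1 + y" "2 * (?w div x) + t * x + 1 \<le> b + 2 * t"
      using quotient[of ?w] by auto
    have "?w = (t + 1 + y) * x + (?r + 1)"
      using div_mult_mod_eq[of ?w x] unfolding y(1) w by simp
    then have "has_standard_linear_realization (lengths x t x b c)"
      using assms(1,3) r rx y(2) unfolding y(1)
      by (intro one_more_realization[where v = ?w and q = "t + 1 + y" and r = "?r + 1"]) simp_all
    then have "has_standard_linear_realization
        (replicate_mset x 1 + (replicate_mset b x + replicate_mset c (t * x)))"
      by (simp add: lengths_def add.assoc)
    from standard_realization_mono[OF this a'] show ?thesis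
      by (simp add: assms(5) add.assoc)
  qed
qed

end
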